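(* Let $w_1,w_2,w_3$ be any odd positive integers. Then for every integer $n\ge 0$ and all $y_1,y_2\in\mathbb{Z}_p$, the following six expressions are equal: \begin{align*} &w_1^n\sum_{k=0}^{n}\binom{n}{k}E_{k,\chi}(w_3y_1)\sum_{a=0}^{w_1d-1}(-1)^a\chi(a)E_{n-k,\chi}\Big(w_2y_2+\frac{w_2}{w_1}a\Big)w_3^{n-k}w_2^k\\ =&w_1^n\sum_{k=0}^{n}\binom{n}{k}E_{k,\chi}(w_2y_1)\sum_{a=0}^{w_1d-1}(-1)^a\chi(a)E_{n-k,\chi}\Big(w_3y_2+\frac{w_3}{w_1}a\Big)w_2^{n-k}w_3^k\\ =&w_2^n\sum_{k=0}^{n}\binom{n}{k}E_{k,\chi}(w_3y_1)\sum_{a=0}^{w_2d-1}(-1)^a\chi(a)E_{n-k,\chi}\Big(w_1y_2+\frac{w_1}{w_2}a\Big)w_3^{n-k}w_1^k\\ =&w_2^n\sum_{k=0}^{n}\binom{n}{k}E_{k,\chi}(w_1y_1)\sum_{a=0}^{w_2d-1}(-1)^a\chi(a)E_{n-k,\chi}\Big(w_3y_2+\frac{w_3}{w_2}a\Big)w_1^{n-k}w_3^k\\ =&w_3^n\sum_{k=0}^{n}\binom{n}{k}E_{k,\chi}(w_2y_1)\sum_{a=0}^{w_3d-1}(-1)^a\chi(a)E_{n-k,\chi}\Big(w_1y_2+\frac{w_1}{w_3}a\Big)w_2^{n-k}w_1^k\\ =&w_3^n\sum_{k=0}^{n}\binom{n}{k}E_{k,\chi}(w_1y_1)\sum_{a=0}^{w_3d-1}(-1)^a\chi(a)E_{n-k,\chi}\Big(w_2y_2+\frac{w_2}{w_3}a\Big)w_1^{n-k}w_2^k.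 \end{align*}
   Context: $p$ is a fixed odd prime, $\mathbb{Z}_p$ is the ring of $p$-adic integers, and $\mathbb{C}_p$ is the completion of an algebraic closure of $\mathbb{Q}_p$. $d$ is a fixed odd positive integer and $\chi$ is a (primitive) Dirichlet character of conductor $d$, with values in $\overline{\mathbb{Q}}$, regarded as $\mathbb{C}_p$-valued through a fixed embedding $\overline{\mathbb{Q}}\to\mathbb{C}_p$; as usual $\chi(a)=0$ when $\gcd(a,d)>1$ (and $\chi\equiv 1$ if $d=1$). The generalized Euler polynomials $E_{n,\chi}(x)$ attached to $\chi$ are the polynomials in $x$ (with coefficients in $\mathbb{C}_p$, so they can be evaluated at any element of $\mathbb{C}_p$) defined by $$\frac{2e^{xt}}{e^{dt}+1}\sum_{a=0}^{d-1}(-1)^a\chi(a)e^{at}=\sum_{n=0}^{\infty}E_{n,\chi}(x)\frac{t^n}{n!}.$$ *)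

theory Defs
  imports
    "HOL-Analysis.Abstract_Metric_Spaces"
    "HOL-Computational_Algebra.Computational_Algebra"
    "HOL-Number_Theory.Cong"
    "HOL-Algebra.Algebraic_Closure_Type"
begin

hide_const (open) Divisibility.prime


section \<open>The field of p-adic complex numbers\<close>

text \<open>
  A model of the field \<open>\<complex>\<^sub>p\<close> is a field \<open>'a\<close> of characteristic zero with an absolute value \<open>v\<close>,
  inside which the usual tower can be carried out:
  \<open>v\<close> restricts to the p-adic absolute value on \<open>\<rat>\<close>; the closure of \<open>\<rat>\<close> in the complete field
  \<open>'a\<close> is \<open>\<rat>\<^sub>p\<close>, the completion of \<open>\<rat>\<close>; the elements of \<open>'a\<close> that are algebraic over \<open>\<rat>\<^sub>p\<close>
  form an algebraic closure of \<open>\<rat>\<^sub>p\<close>; and \<open>'a\<close> is the completion of the latter.  Such a model is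
  unique up to isometric isomorphism.
\<close>

definition padic_abs :: "nat \<Rightarrow> rat \<Rightarrow> real" where
  "padic_abs p r =
     (if r = 0 then 0
      else case quotient_of r of (a, b) \<Rightarrow>
        real p powi (int (multiplicity (int p) b) - int (multiplicity (int p) a)))"

locale abs_valued_field =
  fixes v :: "'a :: field_char_0 \<Rightarrow> real"
  assumes v_nonneg: "0 \<le> v x"
    and v_eq_0_iff: "v x = 0 \<longleftrightarrow> x = 0"
    and v_mult: "v (x * y) = v x * v y"
    and v_add_le: "v (x + y) \<le> v x + v y"
begin

lemma v_minus: "v (- x) = v x"
proof -
  have "v 1 = 1"
    using v_mult[of 1 1] v_eq_0_iff[of 1] by simp
  moreover have "v (- 1) * v (- 1) = v 1"
    using v_mult[of "- 1" "- 1"] by simp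
  ultimately have "v (- 1) = 1"
    using v_nonneg[of "- 1"] by (metis abs_of_nonneg abs_mult_self_eq abs_square_eq_1 power2_eq_square)
  thus ?thesis
    using v_mult[of "- 1" x] by simp
qed

sublocale Metric_space UNIV "\<lambda>x y. v (x - y)"
proof
  show "v (x - z) \<le> v (x - y) + v (y - z)" for x y z
    using v_add_le[of "x - y" "y - z"] by simp
  show "v (x - y) = v (y - x)" for x y
    using v_minus[of "x - y"] by simp
qed (auto simp: v_nonneg v_eq_0_iff)

definition rat_completion :: "'a set" where
  "rat_completion = mtopology closure_of \<rat>"

definition rat_completion_integers :: "'a set" where
  "rat_completion_integers = {x \<in> rat_completion. v x \<le> 1}"

end

definition algebraic_over :: "'a :: field set \<Rightarrow> 'a set" where
  "algebraic_over F = {x. \<exists>f. f \<noteq> 0 \<and> set (coeffs f) \<subseteq> F \<and> poly f x = 0}"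

definition algebraic_closure_of :: "'a :: field set \<Rightarrow> 'a set \<Rightarrow> bool" where
  "algebraic_closure_of A F \<longleftrightarrow>
     A = algebraic_over F \<and>
     (\<forall>f. set (coeffs f) \<subseteq> A \<and> degree f > 0 \<longrightarrow> (\<exists>x\<in>A. poly f x = 0))"

locale padic_complex_field = abs_valued_field v
  for p :: nat and v :: "'a :: field_char_0 \<Rightarrow> real" +
  assumes prime_p: "prime p"
    and v_of_rat: "v (of_rat r) = padic_abs p r"
    and complete: "mcomplete"
    and dense_algebraic_closure:
      "\<exists>A. algebraic_closure_of A rat_completion \<and> mtopology closure_of A = UNIV"

abbreviation padic_integers :: "('a :: field_char_0 \<Rightarrow> real) \<Rightarrow> 'a set" where
  "padic_integers v \<equiv> abs_valued_field.rat_completion_integers v"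

definition field_embedding :: "('b :: field \<Rightarrow> 'a :: field) \<Rightarrow> bool" where
  "field_embedding \<iota> \<longleftrightarrow>
     \<iota> 1 = 1 \<and> (\<forall>x y. \<iota> (x + y) = \<iota> x + \<iota> y) \<and> (\<forall>x y. \<iota> (x * y) = \<iota> x * \<iota> y)"


section \<open>Dirichlet characters\<close>

definition dirichlet_character :: "nat \<Rightarrow> (int \<Rightarrow> 'a :: field) \<Rightarrow> bool" where
  "dirichlet_character d chi \<longleftrightarrow>
     chi 1 = 1 \<and>
     (\<forall>a b. chi (a * b) = chi a * chi b) \<and>
     (\<forall>a b. [a = b] (mod int d) \<longrightarrow> chi a = chi b) \<and>
     (\<forall>a. chi a = 0 \<longleftrightarrow> \<not> coprime a (int d))"

text \<open>
  The conductor of a character modulo \<open>d > 0\<close> is the least divisor \<open>f\<close> of \<open>d\<close> such that the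
  character is trivial on the units congruent to 1 modulo \<open>f\<close>.
\<close>

definition char_conductor :: "nat \<Rightarrow> (int \<Rightarrow> 'a :: field) \<Rightarrow> nat" where
  "char_conductor d chi =
     (LEAST f. f dvd d \<and> (\<forall>a. coprime a (int d) \<and> [a = 1] (mod int f) \<longrightarrow> chi a = 1))"

definition primitive_dirichlet_character :: "nat \<Rightarrow> (int \<Rightarrow> 'a :: field) \<Rightarrow> bool" where
  "primitive_dirichlet_character d chi \<longleftrightarrow> dirichlet_character d chi \<and> char_conductor d chi = d"


section \<open>Generalized Euler polynomials\<close>

text \<open>
  The generating function is a power series in \<open>t\<close> over the polynomial ring in \<open>x\<close>: the first
  factor below is \<open>e\<^sup>x\<^sup>t\<close>, the second one embeds the scalar series.
\<close>

definition gen_euler_scalar_fps :: "nat \<Rightarrow> (int \<Rightarrow> 'a :: field_char_0) \<Rightarrow> 'a fps" where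
  "gen_euler_scalar_fps d chi =
     2 / (fps_exp (of_nat d) + 1) *
       (\<Sum>a<d. fps_const ((-1) ^ a * chi (int a)) * fps_exp (of_nat a))"

definition gen_euler_fps :: "nat \<Rightarrow> (int \<Rightarrow> 'a :: field_char_0) \<Rightarrow> 'a poly fps" where
  "gen_euler_fps d chi =
     Abs_fps (\<lambda>n. monom (1 / fact n) n) * Abs_fps (\<lambda>n. [:fps_nth (gen_euler_scalar_fps d chi) n:])"

definition gen_euler_poly :: "nat \<Rightarrow> (int \<Rightarrow> 'a :: field_char_0) \<Rightarrow> nat \<Rightarrow> 'a poly" where
  "gen_euler_poly d chi n = smult (fact n) (fps_nth (gen_euler_fps d chi) n)"

lemma gen_euler_poly_generating_function:
  "Abs_fps (\<lambda>n. poly (gen_euler_poly d chi n) x / fact n) =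
     2 * fps_exp x / (fps_exp (of_nat d) + 1) *
       (\<Sum>a<d. fps_const ((-1) ^ a * chi (int a)) * fps_exp (of_nat a))"
proof -
  have "Abs_fps (\<lambda>n. poly (gen_euler_poly d chi n) x / fact n) =
          fps_exp x * gen_euler_scalar_fps d chi"
    by (rule fps_ext)
       (simp add: gen_euler_poly_def gen_euler_fps_def fps_mult_nth poly_sum poly_monom mult_ac)
  also have "\<dots> = 2 * fps_exp x / (fps_exp (of_nat d) + 1) *
       (\<Sum>a<d. fps_const ((-1) ^ a * chi (int a)) * fps_exp (of_nat a))"
    by (simp add: gen_euler_scalar_fps_def fps_divide_unit mult_ac)
  finally show ?thesis .
qed

end

(*
  Let F(t) = sum_n E_{n,chi}(0) t^n/n!, so that E_{n,chi}(x) has generating function e^{xt} F(t).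
  By periodicity of chi and a geometric sum, 2 sum_{a<wd} (-1)^a chi(a) e^{at} = F(t) (e^{wdt} + 1)
  for odd w and d. Hence the exponential generating function of the first expression is half of
    e^{w1 w2 w3 (y1 + y2) t} (e^{d w1 w2 w3 t} + 1) F(w1 w2 t) F(w1 w3 t) F(w2 w3 t),
  which is symmetric in w1, w2, w3.
*)
theory Submission
  imports Defs
begin

text \<open>The substitution of \<open>c * t\<close> for \<open>t\<close>, written as a composition
  so that the distributivity rules for \<open>fps_compose\<close> apply.\<close>

abbreviation fps_dilate :: "'a :: field_char_0 \<Rightarrow> 'a fps \<Rightarrow> 'a fps" where
  "fps_dilate c f \<equiv> f oo (fps_const c * fps_X)"

lemma fps_dilate_exp: "fps_dilate c (fps_exp x) = fps_exp (c * x)"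
  by (rule fps_ext) (simp add: fps_compose_linear power_mult_distrib)

text \<open>The geometric sum in \<open>- x\<close>; oddness of \<open>n\<close> turns
  \<open>- ((- x) ^ n)\<close> into \<open>x ^ n\<close>. It will be used with \<open>x\<close>
  equal to the series \<open>fps_exp (of_nat d)\<close>.\<close>

lemma alternating_geometric_sum:
  fixes x :: "'a :: comm_ring_1"
  assumes "odd n"
  shows "(x + 1) * (\<Sum>i<n. (-1) ^ i * x ^ i) = x ^ n + 1"
proof -
  have "1 - (- x) ^ n = (1 - (- x)) * (\<Sum>i<n. (- x) ^ i)"
    by (rule one_diff_power_eq)
  moreover have "(- x) ^ i = (-1) ^ i * x ^ i" for i
    by (rule power_minus)
  ultimately show ?thesis
    using assms by (simp add: add.commute)
qed

text \<open>Cut the range into \<open>w\<close> blocks of length \<open>d\<close>. The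
  \<open>i\<close>-th block is the first one times \<open>(-1) ^ i\<close> and the
  \<open>i\<close>-th power of \<open>fps_exp (of_nat d)\<close>, so a geometric sum splits off; it
  cancels the denominator in \<open>gen_euler_scalar_fps\<close>.\<close>

lemma alternating_character_exp_sum:
  fixes chi :: "int \<Rightarrow> 'a :: field_char_0"
  assumes "odd d" "odd w"
    and periodic: "\<forall>a b. [a = b] (mod int d) \<longrightarrow> chi a = chi b"
  shows "2 * (\<Sum>a<w * d. fps_const ((-1) ^ a * chi (int a)) * fps_exp (of_nat a)) =
           gen_euler_scalar_fps d chi * (fps_exp (of_nat (w * d)) + 1)"
proof -
  let ?g = "\<lambda>a. fps_const ((-1) ^ a * chi (int a)) * fps_exp (of_nat a) :: 'a fps"
  let ?e = "fps_exp (of_nat d) :: 'a fps"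
  let ?s = "\<Sum>a<d. ?g a"
  \<comment> \<open>The constant coefficient is 2, so the quotient defining
    \<open>gen_euler_scalar_fps\<close> is a true inverse.\<close>
  have unit: "fps_nth (?e + 1) 0 \<noteq> 0"
    by simp
  have shift: "?g (j + i * d) = ((-1) ^ i * ?e ^ i) * ?g j" for i j
  proof -
    have "chi (int (j + i * d)) = chi (int j)"
      by (rule periodic[rule_format]) (simp add: cong_def)
    \<comment> \<open>Since \<open>d\<close> is odd, a shift by \<open>i * d\<close> changes the
      sign exactly as a shift by \<open>i\<close> does.\<close>
    moreover have "(-1) ^ (j + i * d) = ((-1) ^ i * (-1) ^ j :: 'a)"
      using \<open>odd d\<close> by (simp add: power_add power_mult mult.commute[of i])
    moreover have "(fps_exp (of_nat (j + i * d)) :: 'a fps) = ?e ^ i * fps_exp (of_nat j)"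
      by (simp add: fps_exp_add_mult fps_exp_power_mult mult.commute)
    moreover have "(-1 :: 'a fps) ^ i = fps_const ((-1) ^ i)"
      by (simp flip: fps_const_power fps_const_neg fps_const_1_eq_1)
    ultimately show ?thesis
      by (simp add: mult_ac flip: fps_const_mult)
  qed
  have "(\<Sum>a<w * d. ?g a) = (\<Sum>i<w. \<Sum>a=i * d..<i * d + d. ?g a)"
    by (rule sum.nat_group[symmetric])
  also have "\<dots> = (\<Sum>i<w. \<Sum>j<d. ?g (j + i * d))"
  proof (rule sum.cong[OF refl])
    fix i
    show "(\<Sum>a=i * d..<i * d + d. ?g a) = (\<Sum>j<d. ?g (j + i * d))"
      using sum.shift_bounds_nat_ivl[of ?g 0 "i * d" d]
      by (simp only: add_0 add.commute[of d] lessThan_atLeast0)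
  qed
  also have "\<dots> = (\<Sum>i<w. (-1) ^ i * ?e ^ i) * ?s"
    by (simp only: shift sum_distrib_left[symmetric] sum_distrib_right[symmetric])
  finally have block: "(\<Sum>a<w * d. ?g a) = (\<Sum>i<w. (-1) ^ i * ?e ^ i) * ?s" .
  have "gen_euler_scalar_fps d chi * (?e + 1) = 2 * ?s"
    using unit inverse_mult_eq_1[OF unit]
    by (simp add: gen_euler_scalar_fps_def fps_divide_unit mult_ac)
  hence "2 * (\<Sum>a<w * d. ?g a) =
      gen_euler_scalar_fps d chi * ((?e + 1) * (\<Sum>i<w. (-1) ^ i * ?e ^ i))"
    unfolding block by (simp add: mult_ac)
  also have "\<dots> = gen_euler_scalar_fps d chi * (fps_exp (of_nat (w * d)) + 1)"
    by (subst alternating_geometric_sum[OF \<open>odd w\<close>]) (simp add: fps_exp_power_mult)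
  finally show ?thesis .
qed

text \<open>Isolates the factor that does not depend on \<open>x\<close>, so that one and the same
  series can later be dilated by different constants.\<close>

lemma gen_euler_poly_fps:
  "Abs_fps (\<lambda>n. poly (gen_euler_poly d chi n) x / fact n) = fps_exp x * gen_euler_scalar_fps d chi"
  by (subst gen_euler_poly_generating_function)
     (simp add: gen_euler_scalar_fps_def fps_divide_unit mult_ac)

lemma binomial_convolution_fps_nth:
  fixes f g :: "nat \<Rightarrow> 'a :: field_char_0"
  shows "(\<Sum>k\<le>n. of_nat (n choose k) * f k * g (n - k)) =
           fact n * fps_nth (Abs_fps (\<lambda>k. f k / fact k) * Abs_fps (\<lambda>k. g k / fact k)) n"
  by (auto simp: fps_mult_nth sum_distrib_left binomial_fact atLeast0AtMost intro!: sum.cong)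

text \<open>The six expressions of the theorem are the values of this one at the six orderings of
  \<open>w1\<close>, \<open>w2\<close>, \<open>w3\<close>. The factors are arranged as in the
  theorem, so that unfolding reproduces it literally.\<close>

definition euler_triple_sum ::
    "nat \<Rightarrow> (int \<Rightarrow> 'a :: field_char_0) \<Rightarrow> nat \<Rightarrow> 'a \<Rightarrow> 'a \<Rightarrow> nat \<Rightarrow> nat \<Rightarrow> nat \<Rightarrow> 'a" where
  "euler_triple_sum d chi n y1 y2 w1 w2 w3 =
     of_nat w1 ^ n * (\<Sum>k\<le>n. of_nat (n choose k) *
       poly (gen_euler_poly d chi k) (of_nat w3 * y1) *
       (\<Sum>a<w1 * d. (-1) ^ a * chi (int a)
          * poly (gen_euler_poly d chi (n - k)) (of_nat w2 * y2 + of_nat w2 / of_nat w1 * of_nat a)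
          * of_nat w3 ^ (n - k) * of_nat w2 ^ k))"

text \<open>One dilated copy of the scalar series for each pair of weights: a permutation of the
  weights only permutes the factors.\<close>

definition euler_triple_fps ::
    "nat \<Rightarrow> (int \<Rightarrow> 'a :: field_char_0) \<Rightarrow> 'a \<Rightarrow> 'a \<Rightarrow> nat \<Rightarrow> nat \<Rightarrow> nat \<Rightarrow> 'a fps" where
  "euler_triple_fps d chi y1 y2 w1 w2 w3 =
     fps_exp (of_nat (w1 * w2 * w3) * (y1 + y2)) * (fps_exp (of_nat (w1 * w2 * w3 * d)) + 1) *
     fps_dilate (of_nat (w1 * w2)) (gen_euler_scalar_fps d chi) *
     fps_dilate (of_nat (w1 * w3)) (gen_euler_scalar_fps d chi) *
     fps_dilate (of_nat (w2 * w3)) (gen_euler_scalar_fps d chi)"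

lemma euler_triple_fps_swap12:
  "euler_triple_fps d chi y1 y2 w1 w2 w3 = euler_triple_fps d chi y1 y2 w2 w1 w3"
  by (simp add: euler_triple_fps_def mult_ac)

lemma euler_triple_fps_swap23:
  "euler_triple_fps d chi y1 y2 w1 w2 w3 = euler_triple_fps d chi y1 y2 w1 w3 w2"
  by (simp add: euler_triple_fps_def mult_ac)

text \<open>Sharing \<open>of_nat w1 ^ n\<close> between the two Euler factors makes the sum a
  binomial convolution, with dilations by \<open>w1 * w2\<close> and \<open>w1 * w3\<close>. The
  remaining character sum supplies the dilation by \<open>w2 * w3\<close>. The factor 2 is the one
  in \<open>alternating_character_exp_sum\<close>.\<close>

lemma euler_triple_sum_eq_fps_nth:
  fixes chi :: "int \<Rightarrow> 'a :: field_char_0"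
  assumes "odd d" "odd w1"
    and periodic: "\<forall>a b. [a = b] (mod int d) \<longrightarrow> chi a = chi b"
  shows "2 * euler_triple_sum d chi n y1 y2 w1 w2 w3 =
           fact n * fps_nth (euler_triple_fps d chi y1 y2 w1 w2 w3) n"
proof -
  let ?F = "gen_euler_scalar_fps d chi"
  let ?E = "\<lambda>k. poly (gen_euler_poly d chi k)"
  let ?x = "\<lambda>a. of_nat w2 * y2 + of_nat w2 / of_nat w1 * of_nat a :: 'a"
  let ?c = "\<lambda>a. (-1) ^ a * chi (int a)"
  define f where "f k = of_nat (w1 * w2) ^ k * ?E k (of_nat w3 * y1)" for k
  define g where "g k = (\<Sum>a<w1 * d. ?c a * (of_nat (w1 * w3) ^ k * ?E k (?x a)))" for k
  have X0: "fps_nth (fps_const c * fps_X) 0 = 0" for c :: 'a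
    by simp
  have w1: "of_nat w1 \<noteq> (0 :: 'a)"
    using \<open>odd w1\<close> by (auto elim: oddE)
  have dilate: "Abs_fps (\<lambda>k. c ^ k * ?E k x / fact k) = fps_exp (c * x) * fps_dilate c ?F" for c x
  proof -
    have "Abs_fps (\<lambda>k. c ^ k * ?E k x / fact k) =
        fps_dilate c (Abs_fps (\<lambda>k. ?E k x / fact k))"
      by (rule fps_ext) (simp add: fps_compose_linear)
    also have "\<dots> = fps_exp (c * x) * fps_dilate c ?F"
      by (simp add: gen_euler_poly_fps fps_compose_mult_distrib fps_dilate_exp)
    finally show ?thesis .
  qed
  have f: "Abs_fps (\<lambda>k. f k / fact k) =
      fps_exp (of_nat (w1 * w2 * w3) * y1) * fps_dilate (of_nat (w1 * w2)) ?F"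
    unfolding f_def dilate by (simp add: mult_ac)
  have "Abs_fps (\<lambda>k. g k / fact k) =
      (\<Sum>a<w1 * d. fps_const (?c a) *
        Abs_fps (\<lambda>k. of_nat (w1 * w3) ^ k * ?E k (?x a) / fact k))"
    by (rule fps_ext) (simp add: g_def fps_sum_nth sum_divide_distrib)
  also have "\<dots> = fps_exp (of_nat (w1 * w2 * w3) * y2) * fps_dilate (of_nat (w1 * w3)) ?F *
      (\<Sum>a<w1 * d. fps_const (?c a) * fps_exp (of_nat (w2 * w3) * of_nat a))"
  proof -
    \<comment> \<open>The dilation constant clears the denominator \<open>w1\<close>, and the part
      depending on \<open>a\<close> becomes an exponent dilated by \<open>w2 * w3\<close>.\<close>
    have "of_nat (w1 * w3) * ?x a =
        of_nat (w1 * w2 * w3) * y2 + of_nat (w2 * w3) * of_nat a" for a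
      using w1 by (simp add: field_simps)
    thus ?thesis
      by (simp only: dilate fps_exp_add_mult sum_distrib_left mult_ac)
  qed
  also have "(\<Sum>a<w1 * d. fps_const (?c a) * fps_exp (of_nat (w2 * w3) * of_nat a)) =
      fps_dilate (of_nat (w2 * w3)) (\<Sum>a<w1 * d. fps_const (?c a) * fps_exp (of_nat a))"
    by (simp add: fps_compose_sum_distrib fps_compose_mult_distrib fps_dilate_exp)
  finally have g: "Abs_fps (\<lambda>k. g k / fact k) =
      fps_exp (of_nat (w1 * w2 * w3) * y2) * fps_dilate (of_nat (w1 * w3)) ?F *
      fps_dilate (of_nat (w2 * w3)) (\<Sum>a<w1 * d. fps_const (?c a) * fps_exp (of_nat a))" .
  have "2 * fps_dilate (of_nat (w2 * w3)) (\<Sum>a<w1 * d. fps_const (?c a) * fps_exp (of_nat a)) =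
      fps_dilate (of_nat (w2 * w3)) (2 * (\<Sum>a<w1 * d. fps_const (?c a) * fps_exp (of_nat a)))"
    by (simp only: mult_2 fps_compose_add_distrib)
  also have "\<dots> = fps_dilate (of_nat (w2 * w3)) ?F * (fps_exp (of_nat (w1 * w2 * w3 * d)) + 1)"
    unfolding alternating_character_exp_sum[OF \<open>odd d\<close> \<open>odd w1\<close> periodic]
    by (simp only: fps_compose_mult_distrib[OF X0] fps_compose_add_distrib fps_dilate_exp
        fps_compose_1) (simp only: of_nat_mult mult_ac)
  finally have s: "2 * fps_dilate (of_nat (w2 * w3))
        (\<Sum>a<w1 * d. fps_const (?c a) * fps_exp (of_nat a)) =
      fps_dilate (of_nat (w2 * w3)) ?F * (fps_exp (of_nat (w1 * w2 * w3 * d)) + 1)" .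
  have "euler_triple_sum d chi n y1 y2 w1 w2 w3 = (\<Sum>k\<le>n. of_nat (n choose k) * f k * g (n - k))"
    unfolding euler_triple_sum_def sum_distrib_left[of "of_nat w1 ^ n"]
  proof (rule sum.cong[OF refl])
    fix k assume "k \<in> {..n}"
    \<comment> \<open>Here \<open>k \<le> n\<close> ensures that the truncated difference
      \<open>n - k\<close> is the true one.\<close>
    hence "(of_nat w1 :: 'a) ^ n = of_nat w1 ^ k * of_nat w1 ^ (n - k)"
      by (simp flip: power_add)
    thus "of_nat w1 ^ n * (of_nat (n choose k) * ?E k (of_nat w3 * y1) *
        (\<Sum>a<w1 * d. ?c a * ?E (n - k) (?x a) * of_nat w3 ^ (n - k) * of_nat w2 ^ k)) =
        of_nat (n choose k) * f k * g (n - k)"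
      by (simp add: f_def g_def sum_distrib_left power_mult_distrib mult_ac)
  qed
  also have "2 * \<dots> =
      fact n * fps_nth (2 * (Abs_fps (\<lambda>k. f k / fact k) * Abs_fps (\<lambda>k. g k / fact k))) n"
    by (simp only: binomial_convolution_fps_nth mult_2 fps_add_nth distrib_left)
  \<comment> \<open>The 2 is moved next to the character sum, where \<open>s\<close> can absorb
    it.\<close>
  also have "2 * (Abs_fps (\<lambda>k. f k / fact k) * Abs_fps (\<lambda>k. g k / fact k)) =
      fps_exp (of_nat (w1 * w2 * w3) * y1) * fps_dilate (of_nat (w1 * w2)) ?F *
      (fps_exp (of_nat (w1 * w2 * w3) * y2) * fps_dilate (of_nat (w1 * w3)) ?F *
      (2 * fps_dilate (of_nat (w2 * w3)) (\<Sum>a<w1 * d. fps_const (?c a) * fps_exp (of_nat a))))"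
    unfolding f g by (simp only: mult_ac)
  also have "\<dots> = euler_triple_fps d chi y1 y2 w1 w2 w3"
    unfolding s by (simp only: euler_triple_fps_def distrib_left[of _ y1] fps_exp_add_mult)
      (simp only: mult_ac)
  finally show ?thesis .
qed

text \<open>Both \<open>w1\<close> and \<open>w2\<close> occur in first position, so the generating
  function is applied once with each of them odd; then 2 is cancelled.\<close>

lemma euler_triple_sum_swap12:
  assumes "odd d" "odd w1" "odd w2"
    and "\<forall>a b. [a = b] (mod int d) \<longrightarrow> chi a = chi b"
  shows "euler_triple_sum d chi n y1 y2 w1 w2 w3 = euler_triple_sum d chi n y1 y2 w2 w1 w3"
proof -
  have "2 * euler_triple_sum d chi n y1 y2 w1 w2 w3 = 2 * euler_triple_sum d chi n y1 y2 w2 w1 w3"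
    by (simp only: euler_triple_sum_eq_fps_nth[OF assms(1,2,4)] euler_triple_sum_eq_fps_nth[OF assms(1,3,4)]
        euler_triple_fps_swap12[of d chi y1 y2 w1 w2 w3])
  thus ?thesis
    by simp
qed

lemma euler_triple_sum_swap23:
  assumes "odd d" "odd w1"
    and "\<forall>a b. [a = b] (mod int d) \<longrightarrow> chi a = chi b"
  shows "euler_triple_sum d chi n y1 y2 w1 w2 w3 = euler_triple_sum d chi n y1 y2 w1 w3 w2"
proof -
  have "2 * euler_triple_sum d chi n y1 y2 w1 w2 w3 = 2 * euler_triple_sum d chi n y1 y2 w1 w3 w2"
    by (simp only: euler_triple_sum_eq_fps_nth[OF assms]
        euler_triple_fps_swap23[of d chi y1 y2 w1 w2 w3])
  thus ?thesis
    by simp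
qed

theorem theorem4p3:
  fixes p d n w1 w2 w3 :: nat
    and v :: "'a :: field_char_0 \<Rightarrow> real"
    and \<iota> :: "rat alg_closure \<Rightarrow> 'a"
    and chi :: "int \<Rightarrow> rat alg_closure"
    and y1 y2 :: 'a
  assumes "odd p"
    and "padic_complex_field p v"
    and "field_embedding \<iota>"
    and "odd d"
    and "primitive_dirichlet_character d chi"
    and "odd w1" and "odd w2" and "odd w3"
    and "y1 \<in> padic_integers v" and "y2 \<in> padic_integers v"
  shows
    "let E = (\<lambda>k. poly (gen_euler_poly d (\<lambda>a. \<iota> (chi a)) k));
         S1 = of_nat w1 ^ n * (\<Sum>k\<le>n. of_nat (n choose k) * E k (of_nat w3 * y1) *
           (\<Sum>a<w1 * d. (-1) ^ a * \<iota> (chi (int a))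
              * E (n - k) (of_nat w2 * y2 + of_nat w2 / of_nat w1 * of_nat a)
              * of_nat w3 ^ (n - k) * of_nat w2 ^ k));
         S2 = of_nat w1 ^ n * (\<Sum>k\<le>n. of_nat (n choose k) * E k (of_nat w2 * y1) *
           (\<Sum>a<w1 * d. (-1) ^ a * \<iota> (chi (int a))
              * E (n - k) (of_nat w3 * y2 + of_nat w3 / of_nat w1 * of_nat a)
              * of_nat w2 ^ (n - k) * of_nat w3 ^ k));
         S3 = of_nat w2 ^ n * (\<Sum>k\<le>n. of_nat (n choose k) * E k (of_nat w3 * y1) *
           (\<Sum>a<w2 * d. (-1) ^ a * \<iota> (chi (int a))
              * E (n - k) (of_nat w1 * y2 + of_nat w1 / of_nat w2 * of_nat a)
              * of_nat w3 ^ (n - k) * of_nat w1 ^ k));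
         S4 = of_nat w2 ^ n * (\<Sum>k\<le>n. of_nat (n choose k) * E k (of_nat w1 * y1) *
           (\<Sum>a<w2 * d. (-1) ^ a * \<iota> (chi (int a))
              * E (n - k) (of_nat w3 * y2 + of_nat w3 / of_nat w2 * of_nat a)
              * of_nat w1 ^ (n - k) * of_nat w3 ^ k));
         S5 = of_nat w3 ^ n * (\<Sum>k\<le>n. of_nat (n choose k) * E k (of_nat w2 * y1) *
           (\<Sum>a<w3 * d. (-1) ^ a * \<iota> (chi (int a))
              * E (n - k) (of_nat w1 * y2 + of_nat w1 / of_nat w3 * of_nat a)
              * of_nat w2 ^ (n - k) * of_nat w1 ^ k));
         S6 = of_nat w3 ^ n * (\<Sum>k\<le>n. of_nat (n choose k) * E k (of_nat w1 * y1) *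
           (\<Sum>a<w3 * d. (-1) ^ a * \<iota> (chi (int a))
              * E (n - k) (of_nat w2 * y2 + of_nat w2 / of_nat w3 * of_nat a)
              * of_nat w1 ^ (n - k) * of_nat w2 ^ k))
     in S1 = S2 \<and> S2 = S3 \<and> S3 = S4 \<and> S4 = S5 \<and> S5 = S6"
proof -
  let ?S = "euler_triple_sum d (\<lambda>a. \<iota> (chi a)) n y1 y2"
  have periodic: "\<forall>a b. [a = b] (mod int d) \<longrightarrow> \<iota> (chi a) = \<iota> (chi b)"
  proof (intro allI impI)
    fix a b assume "[a = b] (mod int d)"
    hence "chi a = chi b"
      using assms(5) unfolding primitive_dirichlet_character_def dirichlet_character_def by blast
    thus "\<iota> (chi a) = \<iota> (chi b)"
      by (rule arg_cong)
  qed
  note swap12 = euler_triple_sum_swap12[where chi = "\<lambda>a. \<iota> (chi a)", OF \<open>odd d\<close> _ _ periodic]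
  note swap23 = euler_triple_sum_swap23[where chi = "\<lambda>a. \<iota> (chi a)", OF \<open>odd d\<close> _ periodic]
  \<comment> \<open>Five adjacent transpositions connect all six orderings. The first expression is
    linked to the second and to the third; from the third the links run on to the fourth, the sixth
    and the fifth.\<close>
  have "?S w1 w2 w3 = ?S w1 w3 w2"
    using \<open>odd w1\<close> by (rule swap23)
  moreover have "?S w1 w2 w3 = ?S w2 w1 w3"
    using \<open>odd w1\<close> \<open>odd w2\<close> by (rule swap12)
  moreover have "?S w2 w1 w3 = ?S w2 w3 w1"
    using \<open>odd w2\<close> by (rule swap23)
  moreover have "?S w2 w3 w1 = ?S w3 w2 w1"
    using \<open>odd w2\<close> \<open>odd w3\<close> by (rule swap12)
  moreover have "?S w3 w2 w1 = ?S w3 w1 w2"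
    using \<open>odd w3\<close> by (rule swap23)
  ultimately have "?S w1 w2 w3 = ?S w1 w3 w2 \<and> ?S w1 w3 w2 = ?S w2 w1 w3 \<and>
      ?S w2 w1 w3 = ?S w2 w3 w1 \<and> ?S w2 w3 w1 = ?S w3 w1 w2 \<and> ?S w3 w1 w2 = ?S w3 w2 w1"
    by simp
  thus ?thesis
    unfolding Let_def euler_triple_sum_def .
qed

end
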